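(* The dual vector space of a finite-dimensional $n$-ary partially associative algebra has an $n$-ary partially coassociative coalgebra structure.
   Context: $\mathbb{K}$ is a commutative field of characteristic $0$, all vector spaces are over $\mathbb{K}$, and $n$ is a natural number; $Id_q$ is the identity of the $q$-th tensor power ($Id_0$ means no operation). An $n$-ary partially associative algebra is a vector space $\mathcal A$ with a linear map $\mu:\mathcal A^{\otimes n}\to\mathcal A$ such that $\sum_{p=0}^{n-1}(-1)^{p(n-1)}\mu\circ(Id_p\otimes\mu\otimes Id_{n-1-p})=0$. An $n$-ary partially coassociative coalgebra is a vector space $M$ with a linear map $\Delta:M\to M^{\otimes n}$ such that $\sum_{p=0}^{n-1}(-1)^{p(n-1)}(Id_p\otimes\Delta\otimes Id_{n-1-p})\circ\Delta=0$. The dual vector space of $\mathcal A$ is $\mathcal A^*=\mathrm{Hom}_{\mathbb{K}}(\mathcal A,\mathbb{K})$. *)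

theory Defs
  imports Complex_Main "HOL-Library.Function_Algebras"
begin

text \<open>A vector space is a subspace \<open>V\<close> of an ambient \<^locale>\<open>vector_space\<close>; taking
  \<open>V = UNIV\<close> gives the ambient space itself. Only the values of maps on the carriers matter.\<close>

definition linear_on ::
  "('k \<Rightarrow> 'a \<Rightarrow> 'a) \<Rightarrow> ('k \<Rightarrow> 'b \<Rightarrow> 'b) \<Rightarrow> 'a::ab_group_add set \<Rightarrow> 'b::ab_group_add set \<Rightarrow> ('a \<Rightarrow> 'b) \<Rightarrow> bool"
  where "linear_on s s' V W f \<longleftrightarrow>
    (\<forall>x\<in>V. f x \<in> W) \<and>
    (\<forall>x\<in>V. \<forall>y\<in>V. f (x + y) = f x + f y) \<and>
    (\<forall>c. \<forall>x\<in>V. f (s c x) = s' c (f x))"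

definition vecs :: "nat \<Rightarrow> 'a set \<Rightarrow> 'a list set"
  where "vecs n V = {vs. length vs = n \<and> set vs \<subseteq> V}"

definition multilinear_on ::
  "nat \<Rightarrow> ('k \<Rightarrow> 'a \<Rightarrow> 'a) \<Rightarrow> ('k \<Rightarrow> 'b \<Rightarrow> 'b) \<Rightarrow> 'a::ab_group_add set \<Rightarrow> 'b::ab_group_add set \<Rightarrow>
    ('a list \<Rightarrow> 'b) \<Rightarrow> bool"
  where "multilinear_on n s s' V W g \<longleftrightarrow>
    (\<forall>vs\<in>vecs n V. g vs \<in> W) \<and>
    (\<forall>p q xs zs. p + 1 + q = n \<longrightarrow> xs \<in> vecs p V \<longrightarrow> zs \<in> vecs q V \<longrightarrow>
      linear_on s s' V W (\<lambda>v. g (xs @ v # zs)))"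

definition pw_scale :: "'k::times \<Rightarrow> ('i \<Rightarrow> 'k) \<Rightarrow> 'i \<Rightarrow> 'k"
  where "pw_scale c f = (\<lambda>i. c * f i)"

text \<open>The \<open>n\<close>-th tensor power of \<open>V\<close> is realised inside the dual of the space of \<open>n\<close>-linear forms on
  \<open>V\<close>, with \<open>v\<^sub>1 \<otimes> \<dots> \<otimes> v\<^sub>n\<close> being evaluation at \<open>(v\<^sub>1, \<dots>, v\<^sub>n)\<close>. That this is the tensor power
  is the universal property, proved below (\<open>tensor_power_universal\<close>).\<close>

type_synonym ('k, 'a) tensor = "('a list \<Rightarrow> 'k) \<Rightarrow> 'k"

definition pure_tensor :: "('k::field \<Rightarrow> 'a \<Rightarrow> 'a) \<Rightarrow> 'a::ab_group_add set \<Rightarrow> 'a list \<Rightarrow> ('k, 'a) tensor"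
  where "pure_tensor s V vs = (\<lambda>\<phi>. if multilinear_on (length vs) s (*) V UNIV \<phi> then \<phi> vs else 0)"

definition tensor_power :: "('k::field \<Rightarrow> 'a \<Rightarrow> 'a) \<Rightarrow> 'a::ab_group_add set \<Rightarrow> nat \<Rightarrow> ('k, 'a) tensor set"
  where "tensor_power s V n = module.span pw_scale (pure_tensor s V ` vecs n V)"

text \<open>An isomorphism from \<open>V\<close> onto its first tensor power: see \<open>bij_betw_tensor1\<close>.\<close>

definition tensor1 :: "('k::field \<Rightarrow> 'a \<Rightarrow> 'a) \<Rightarrow> 'a::ab_group_add set \<Rightarrow> 'a \<Rightarrow> ('k, 'a) tensor"
  where "tensor1 s V v = pure_tensor s V [v]"

text \<open>\<open>id_tensor_id s V p k f l q\<close> is \<open>Id\<^sub>p \<otimes> f \<otimes> Id\<^sub>q\<close> for \<open>f\<close> from the \<open>k\<close>-th to the \<open>l\<close>-th tensor power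
  of \<open>V\<close>, written out on elements as functionals on multilinear forms. It is characterised by
  linearity and by its values on pure tensors: see \<open>linear_on_id_tensor_id\<close> and \<open>id_tensor_id_pure\<close>.\<close>

definition id_tensor_id ::
  "('k::field \<Rightarrow> 'a \<Rightarrow> 'a) \<Rightarrow> 'a::ab_group_add set \<Rightarrow> nat \<Rightarrow> nat \<Rightarrow> (('k, 'a) tensor \<Rightarrow> ('k, 'a) tensor) \<Rightarrow>
    nat \<Rightarrow> nat \<Rightarrow> ('k, 'a) tensor \<Rightarrow> ('k, 'a) tensor"
  where "id_tensor_id s V p k f l q t = (\<lambda>\<phi>.
    if multilinear_on (p + l + q) s (*) V UNIV \<phi>
    then t (\<lambda>us. f (pure_tensor s V (take k (drop p us)))
                   (\<lambda>ws. \<phi> (take p us @ ws @ drop (p + k) us)))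
    else 0)"

text \<open>\<open>tensor1\<close> converts between \<open>\<mu> : A\<^sup>\<otimes>\<^sup>n \<rightarrow> A\<close>, \<open>\<Delta> : M \<rightarrow> M\<^sup>\<otimes>\<^sup>n\<close> and maps of tensor powers, as required by
  \<^const>\<open>id_tensor_id\<close>. The exponent \<open>n + (n - 1)\<close> is \<open>2n - 1\<close>; for \<open>n = 0\<close> the sums are empty.\<close>

definition partially_associative_algebra ::
  "nat \<Rightarrow> ('k::field_char_0 \<Rightarrow> 'a \<Rightarrow> 'a) \<Rightarrow> 'a::ab_group_add set \<Rightarrow> (('k, 'a) tensor \<Rightarrow> 'a) \<Rightarrow> bool"
  where "partially_associative_algebra n s A \<mu> \<longleftrightarrow>
    vector_space s \<and> module.subspace s A \<and>
    linear_on pw_scale s (tensor_power s A n) A \<mu> \<and>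
    (\<forall>t \<in> tensor_power s A (n + (n - 1)).
      (\<Sum>p<n. s ((-1) ^ (p * (n - 1)))
        (\<mu> (id_tensor_id s A p n (\<lambda>u. tensor1 s A (\<mu> u)) 1 (n - 1 - p) t))) = 0)"

definition partially_coassociative_coalgebra ::
  "nat \<Rightarrow> ('k::field_char_0 \<Rightarrow> 'a \<Rightarrow> 'a) \<Rightarrow> 'a::ab_group_add set \<Rightarrow> ('a \<Rightarrow> ('k, 'a) tensor) \<Rightarrow> bool"
  where "partially_coassociative_coalgebra n s M \<Delta> \<longleftrightarrow>
    vector_space s \<and> module.subspace s M \<and>
    linear_on s pw_scale M (tensor_power s M n) \<Delta> \<and>
    (\<forall>x \<in> M.
      (\<Sum>p<n. pw_scale ((-1) ^ (p * (n - 1)))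
        (id_tensor_id s M p 1 (\<lambda>u. \<Delta> (the_inv_into M (tensor1 s M) u)) n (n - 1 - p) (\<Delta> x))) = 0)"

definition dual_space :: "('k::field \<Rightarrow> 'a \<Rightarrow> 'a) \<Rightarrow> ('a::ab_group_add \<Rightarrow> 'k) set"
  where "dual_space s = {f. Vector_Spaces.linear s (*) f}"

text \<open>The canonical map from the \<open>n\<close>-th tensor power of the dual to the dual of the \<open>n\<close>-th tensor power,
  sending \<open>f\<^sub>1 \<otimes> \<dots> \<otimes> f\<^sub>n\<close> to the functional \<open>a\<^sub>1 \<otimes> \<dots> \<otimes> a\<^sub>n \<mapsto> f\<^sub>1 a\<^sub>1 \<cdots> f\<^sub>n a\<^sub>n\<close>
  (see \<open>dual_tensor_map_pure\<close>).\<close>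

definition dual_tensor_map :: "nat \<Rightarrow> ('k::field, 'a \<Rightarrow> 'k) tensor \<Rightarrow> ('k, 'a) tensor \<Rightarrow> 'k"
  where "dual_tensor_map n u t = t (\<lambda>as. u (\<lambda>fs. \<Prod>i<n. (fs ! i) (as ! i)))"

lemma vector_space_pw_scale: "vector_space (pw_scale :: 'k::field \<Rightarrow> ('i \<Rightarrow> 'k) \<Rightarrow> 'i \<Rightarrow> 'k)"
  by unfold_locales (auto simp: pw_scale_def fun_eq_iff algebra_simps)

lemma vector_space_times: "vector_space ((*) :: 'k::field \<Rightarrow> 'k \<Rightarrow> 'k)"
  by unfold_locales (auto simp: algebra_simps)

interpretation pw: vector_space "pw_scale :: 'k::field \<Rightarrow> ('i \<Rightarrow> 'k) \<Rightarrow> 'i \<Rightarrow> 'k"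
  by (rule vector_space_pw_scale)

lemma linear_onI:
  assumes "\<And>x. x \<in> V \<Longrightarrow> f x \<in> W"
    and "\<And>x y. x \<in> V \<Longrightarrow> y \<in> V \<Longrightarrow> f (x + y) = f x + f y"
    and "\<And>c x. x \<in> V \<Longrightarrow> f (s c x) = s' c (f x)"
  shows "linear_on s s' V W f"
  using assms by (auto simp: linear_on_def)

lemma linear_onD:
  assumes "linear_on s s' V W f"
  shows "x \<in> V \<Longrightarrow> f x \<in> W"
    and "x \<in> V \<Longrightarrow> y \<in> V \<Longrightarrow> f (x + y) = f x + f y"
    and "x \<in> V \<Longrightarrow> f (s c x) = s' c (f x)"
  using assms by (auto simp: linear_on_def)

lemma linear_on_UNIV:
  assumes "vector_space s" "vector_space s'"
  shows "linear_on s s' UNIV UNIV f \<longleftrightarrow> Vector_Spaces.linear s s' f"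
  using assms by (auto simp: linear_on_def Vector_Spaces.linear_iff)

lemma vecs_append: "xs \<in> vecs p V \<Longrightarrow> ys \<in> vecs q V \<Longrightarrow> xs @ ys \<in> vecs (p + q) V"
  by (auto simp: vecs_def)

lemma vecs_insert: "xs \<in> vecs p V \<Longrightarrow> zs \<in> vecs q V \<Longrightarrow> v \<in> V \<Longrightarrow> xs @ v # zs \<in> vecs (p + 1 + q) V"
  by (auto simp: vecs_def)

lemma multilinear_onD:
  assumes "multilinear_on n s s' V W g"
  shows "vs \<in> vecs n V \<Longrightarrow> g vs \<in> W"
    and "p + 1 + q = n \<Longrightarrow> xs \<in> vecs p V \<Longrightarrow> zs \<in> vecs q V \<Longrightarrow>
      linear_on s s' V W (\<lambda>v. g (xs @ v # zs))"
  using assms unfolding multilinear_on_def by blast+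

lemma multilinear_onI:
  assumes "\<And>vs. vs \<in> vecs n V \<Longrightarrow> g vs \<in> W"
    and "\<And>p q xs zs. p + 1 + q = n \<Longrightarrow> xs \<in> vecs p V \<Longrightarrow> zs \<in> vecs q V \<Longrightarrow>
      linear_on s s' V W (\<lambda>v. g (xs @ v # zs))"
  shows "multilinear_on n s s' V W g"
  using assms unfolding multilinear_on_def by blast

lemma pure_tensor_apply:
  "vs \<in> vecs n V \<Longrightarrow> multilinear_on n s (*) V UNIV \<phi> \<Longrightarrow> pure_tensor s V vs \<phi> = \<phi> vs"
  by (auto simp: pure_tensor_def vecs_def)

lemma pure_in_tensor_power: "vs \<in> vecs n V \<Longrightarrow> pure_tensor s V vs \<in> tensor_power s V n"
  unfolding tensor_power_def by (rule pw.span_base) simp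

lemma subspace_tensor_power: "module.subspace pw_scale (tensor_power s V n)"
  unfolding tensor_power_def by (rule pw.subspace_span)

lemma tensor_power_nonmultilinear:
  assumes "t \<in> tensor_power s V n" "\<not> multilinear_on n s (*) V UNIV \<phi>"
  shows "t \<phi> = 0"
  using assms(1) unfolding tensor_power_def
proof (induction rule: pw.span_induct_alt)
  case (step c x y)
  then show ?case using assms(2) by (auto simp: pw_scale_def pure_tensor_def vecs_def)
qed simp

lemma tensor_power_induct [consumes 1, case_names zero step]:
  assumes "t \<in> tensor_power s V n"
    and "P 0"
    and "\<And>c vs t. vs \<in> vecs n V \<Longrightarrow> t \<in> tensor_power s V n \<Longrightarrow> P t \<Longrightarrow> P (pw_scale c (pure_tensor s V vs) + t)"
  shows "P t"
proof -
  have "t \<in> tensor_power s V n \<and> P t"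
    using assms(1) unfolding tensor_power_def
  proof (induction rule: pw.span_induct_alt)
    case base
    then show ?case using assms(2) pw.span_zero by blast
  next
    case (step c x y)
    then obtain vs where vs: "vs \<in> vecs n V" "x = pure_tensor s V vs" by blast
    have y: "y \<in> tensor_power s V n" "P y" using step by (auto simp: tensor_power_def)
    have "pw_scale c x + y \<in> pw.span (pure_tensor s V ` vecs n V)"
      using step by (intro pw.span_add pw.span_scale pw.span_base conjunct1[OF step(2)])
    with assms(3)[OF vs(1) y] vs(2) show ?case by (simp add: plus_fun_def del: plus_fun_apply)
  qed
  then show ?thesis ..
qed

lemma multilinear_on_pure_tensor:
  assumes V: "module.subspace s V" and s: "vector_space s"
  shows "multilinear_on n s pw_scale V (tensor_power s V n) (pure_tensor s V)"
proof (rule multilinear_onI)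
  interpret s: vector_space s by fact
  fix p q xs zs assume n: "p + 1 + q = n" and xs: "xs \<in> vecs p V" and zs: "zs \<in> vecs q V"
  have len: "length (xs @ v # zs) = n" for v using xs zs n by (auto simp: vecs_def)
  show "linear_on s pw_scale V (tensor_power s V n) (\<lambda>v. pure_tensor s V (xs @ v # zs))"
  proof (rule linear_onI)
    fix x assume "x \<in> V"
    then show "pure_tensor s V (xs @ x # zs) \<in> tensor_power s V n"
      using vecs_insert[OF xs zs] n pure_in_tensor_power by blast
  next
    fix x y assume "x \<in> V" "y \<in> V"
    then show "pure_tensor s V (xs @ (x + y) # zs) = pure_tensor s V (xs @ x # zs) + pure_tensor s V (xs @ y # zs)"
      unfolding pure_tensor_def len
      by (auto simp: fun_eq_iff intro: linear_onD(2)[OF multilinear_onD(2)[OF _ n xs zs]])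
  next
    fix c x assume "x \<in> V"
    then show "pure_tensor s V (xs @ s c x # zs) = pw_scale c (pure_tensor s V (xs @ x # zs))"
      unfolding pure_tensor_def len
      by (auto simp: fun_eq_iff pw_scale_def intro: linear_onD(3)[OF multilinear_onD(2)[OF _ n xs zs]])
  qed
qed (rule pure_in_tensor_power)

lemma linear_on_eq_tensor_power:
  assumes s': "vector_space s'"
    and h: "linear_on pw_scale s' (tensor_power s V n) W h"
    and h': "linear_on pw_scale s' (tensor_power s V n) W h'"
    and eq: "\<And>vs. vs \<in> vecs n V \<Longrightarrow> h (pure_tensor s V vs) = h' (pure_tensor s V vs)"
    and t: "t \<in> tensor_power s V n"
  shows "h t = h' t"
proof -
  interpret s': vector_space s' by fact
  note sub = subspace_tensor_power[of s V n]
  have z: "0 \<in> tensor_power s V n" using sub by (rule pw.subspace_0)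
  show ?thesis using t
  proof (induction rule: tensor_power_induct)
    case zero
    have "h (pw_scale 0 0) = s' 0 (h 0)" "h' (pw_scale 0 0) = s' 0 (h' 0)"
      using linear_onD(3)[OF h z] linear_onD(3)[OF h' z] by blast+
    then show ?case by (simp del: zero_fun_apply)
  next
    case (step c vs t)
    have a: "pure_tensor s V vs \<in> tensor_power s V n"
      using step by (blast intro: pure_in_tensor_power)
    have b: "pw_scale c (pure_tensor s V vs) \<in> tensor_power s V n"
      using pw.subspace_scale[OF sub a] .
    show ?case
      unfolding linear_onD(2)[OF h b step(2)] linear_onD(2)[OF h' b step(2)]
        linear_onD(3)[OF h a] linear_onD(3)[OF h' a] eq[OF step(1)] step(3) ..
  qed
qed

theorem tensor_power_universal:
  fixes s :: "'k::field \<Rightarrow> 'a::ab_group_add \<Rightarrow> 'a" and s' :: "'k \<Rightarrow> 'b::ab_group_add \<Rightarrow> 'b"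
  assumes s': "vector_space s'" and W: "module.subspace s' W"
    and g: "multilinear_on n s s' V W g"
  shows "\<exists>h. linear_on pw_scale s' (tensor_power s V n) W h \<and>
    (\<forall>vs\<in>vecs n V. h (pure_tensor s V vs) = g vs) \<and>
    (\<forall>h'. linear_on pw_scale s' (tensor_power s V n) W h' \<longrightarrow>
      (\<forall>vs\<in>vecs n V. h' (pure_tensor s V vs) = g vs) \<longrightarrow>
      (\<forall>t\<in>tensor_power s V n. h' t = h t))"
proof -
  interpret s': vector_space s' by fact
  interpret u: vector_space_pair "pw_scale :: 'k \<Rightarrow> ('k, 'a) tensor \<Rightarrow> _" s' ..
  interpret k: vector_space "(*) :: 'k \<Rightarrow> 'k \<Rightarrow> 'k" by (rule vector_space_times)
  interpret sk: vector_space_pair s' "(*) :: 'k \<Rightarrow> 'k \<Rightarrow> 'k" ..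
  interpret pk: vector_space_pair "pw_scale :: 'k \<Rightarrow> ('k, 'a) tensor \<Rightarrow> _" "(*) :: 'k \<Rightarrow> 'k \<Rightarrow> 'k" ..
  let ?P = "pure_tensor s V ` vecs n V"
  obtain B where B: "B \<subseteq> ?P" "pw.independent B" "?P \<subseteq> pw.span B"
    by (rule pw.maximal_independent_subset)
  define r where "r b = (SOME vs. vs \<in> vecs n V \<and> pure_tensor s V vs = b)" for b
  have r: "r b \<in> vecs n V \<and> pure_tensor s V (r b) = b" if "b \<in> B" for b
  proof -
    have "\<exists>vs. vs \<in> vecs n V \<and> pure_tensor s V vs = b"
      using subsetD[OF B(1) that] by auto
    then show ?thesis unfolding r_def by (rule someI_ex)
  qed
  define h where "h = u.construct B (\<lambda>b. g (r b))"
  have lin: "Vector_Spaces.linear pw_scale s' h"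
    unfolding h_def by (rule u.linear_construct) fact
  have h_pure: "h (pure_tensor s V vs) = g vs" if vs: "vs \<in> vecs n V" for vs
  proof (rule ccontr)
    assume "h (pure_tensor s V vs) \<noteq> g vs"
    define w where "w = h (pure_tensor s V vs) - g vs"
    have "w \<noteq> 0" using \<open>h (pure_tensor s V vs) \<noteq> g vs\<close> by (simp add: w_def)
    then have "s'.independent {w}" by simp
    then obtain l where l: "Vector_Spaces.linear s' (*) l" "l w = 1"
      using sk.linear_independent_extend[of "{w}" "\<lambda>_. 1"] by auto
    interpret l: Vector_Spaces.linear s' "(*)" l by fact
    have lg: "multilinear_on n s (*) V UNIV (\<lambda>vs. l (g vs))"
    proof (rule multilinear_onI)
      fix p q xs zs assume a: "p + 1 + q = n" "xs \<in> vecs p V" "zs \<in> vecs q V"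
      show "linear_on s (*) V UNIV (\<lambda>v. l (g (xs @ v # zs)))"
        using linear_onD[OF multilinear_onD(2)[OF g a]]
        by (intro linear_onI) (auto simp: l.add l.scale)
    qed simp
    have lin1: "Vector_Spaces.linear pw_scale (*) (\<lambda>t. l (h t))"
      using Vector_Spaces.linear_compose[OF lin l(1)] by (simp add: o_def)
    have lin2: "Vector_Spaces.linear pw_scale (*) (\<lambda>t::('k, 'a) tensor. t (\<lambda>vs. l (g vs)))"
      by (auto simp: Vector_Spaces.linear_iff pw_scale_def vector_space_pw_scale vector_space_times)
    have on_B: "l (h b) = b (\<lambda>vs. l (g vs))" if "b \<in> B" for b
    proof -
      have "b (\<lambda>vs. l (g vs)) = l (g (r b))"
        using pure_tensor_apply[OF conjunct1[OF r[OF that]] lg] conjunct2[OF r[OF that]] by simp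
      then show ?thesis using u.construct_basis[OF B(2) that] by (simp add: h_def)
    qed
    have in_span: "pure_tensor s V vs \<in> pw.span B" by (rule subsetD[OF B(3) imageI[OF vs]])
    have "l (h (pure_tensor s V vs)) = pure_tensor s V vs (\<lambda>vs. l (g vs))"
      by (rule pk.linear_eq_on[OF lin1 lin2 in_span on_B])
    also have "\<dots> = l (g vs)" using pure_tensor_apply[OF vs lg] .
    finally have "l w = 0" by (simp add: w_def l.diff)
    with l(2) show False by simp
  qed
  have ran: "h t \<in> W" if "t \<in> tensor_power s V n" for t
    using that
  proof (induction rule: tensor_power_induct)
    case zero
    then show ?case using u.linear_0[OF lin] s'.subspace_0[OF W] by (simp del: zero_fun_apply)
  next
    case (step c vs t)
    then show ?case
      using multilinear_onD(1)[OF g] h_pure s'.subspace_add[OF W] s'.subspace_scale[OF W]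
      by (simp del: plus_fun_apply add: u.linear_add[OF lin] u.linear_scale[OF lin])
  qed
  have lo: "linear_on pw_scale s' (tensor_power s V n) W h"
    using ran u.linear_add[OF lin] u.linear_scale[OF lin] by (intro linear_onI) auto
  show ?thesis
  proof (intro exI[of _ h] conjI ballI allI impI)
    fix h' t
    assume h': "linear_on pw_scale s' (tensor_power s V n) W h'"
      "\<forall>vs\<in>vecs n V. h' (pure_tensor s V vs) = g vs" and t: "t \<in> tensor_power s V n"
    show "h' t = h t"
      by (rule linear_on_eq_tensor_power[OF s' h'(1) lo _ t]) (simp add: h'(2) h_pure)
  qed (fact lo, rule h_pure)
qed

lemma linear_on_tensor1:
  assumes "vector_space s" "module.subspace s V"
  shows "linear_on s pw_scale V (tensor_power s V 1) (tensor1 s V)"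
  using multilinear_onD(2)[OF multilinear_on_pure_tensor[OF assms(2,1), of 1], of 0 0 "[]" "[]"]
  by (simp add: tensor1_def[abs_def] vecs_def)

lemma bij_betw_tensor1:
  fixes s :: "'k::field \<Rightarrow> 'a::ab_group_add \<Rightarrow> 'a"
  assumes s: "vector_space s" and V: "module.subspace s V"
  shows "bij_betw (tensor1 s V) V (tensor_power s V 1)"
proof -
  interpret s: vector_space s by fact
  note lin = linear_on_tensor1[OF s V]
  have "multilinear_on 1 s s V V hd"
  proof (rule multilinear_onI)
    fix vs assume "vs \<in> vecs 1 V"
    then show "hd vs \<in> V" by (cases vs) (auto simp: vecs_def)
  next
    fix p q xs zs assume "p + 1 + q = (1::nat)" "xs \<in> vecs p V"
    then show "linear_on s s V V (\<lambda>v. hd (xs @ v # zs))"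
      by (intro linear_onI) (auto simp: vecs_def)
  qed
  then obtain h where h: "\<And>vs. vs \<in> vecs 1 V \<Longrightarrow> h (pure_tensor s V vs) = hd vs"
    using tensor_power_universal[OF s V] by metis
  have "inj_on (tensor1 s V) V"
  proof (rule inj_on_inverseI[where g = h])
    fix x assume "x \<in> V"
    then show "h (tensor1 s V x) = x" using h[of "[x]"] by (simp add: tensor1_def vecs_def)
  qed
  moreover have "t \<in> tensor1 s V ` V" if "t \<in> tensor_power s V 1" for t
    using that
  proof (induction rule: tensor_power_induct)
    case zero
    have "tensor1 s V (s 0 0) = pw_scale 0 (tensor1 s V 0)"
      using linear_onD(3)[OF lin s.subspace_0[OF V]] .
    then show ?case using s.subspace_0[OF V] by (metis pw.scale_zero_left s.scale_zero_left image_eqI)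
  next
    case (step c vs t)
    then obtain v where v: "vs = [v]" "v \<in> V" by (cases vs) (auto simp: vecs_def)
    from step obtain x where x: "x \<in> V" "t = tensor1 s V x" by blast
    have "tensor1 s V (s c v + x) = pw_scale c (pure_tensor s V vs) + t"
      using v x s.subspace_scale[OF V] linear_onD(2,3)[OF lin] by (simp add: tensor1_def)
    then show ?case using v x s.subspace_scale[OF V] s.subspace_add[OF V] by (metis image_eqI)
  qed
  ultimately show ?thesis using linear_onD(1)[OF lin] by (auto simp: bij_betw_def)
qed

lemma multilinear_on_sandwich:
  assumes \<phi>: "multilinear_on (p + l + q) s (*) V UNIV \<phi>" and xs: "xs \<in> vecs p V" and zs: "zs \<in> vecs q V"
  shows "multilinear_on l s (*) V UNIV (\<lambda>ws. \<phi> (xs @ ws @ zs))"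
proof (rule multilinear_onI)
  fix p' q' xs' zs' assume a: "p' + 1 + q' = l" "xs' \<in> vecs p' V" "zs' \<in> vecs q' V"
  show "linear_on s (*) V UNIV (\<lambda>v. \<phi> (xs @ (xs' @ v # zs') @ zs))"
    using multilinear_onD(2)[OF \<phi>, of "p + p'" "q' + q" "xs @ xs'" "zs' @ zs"] a
      vecs_append[OF xs a(2)] vecs_append[OF a(3) zs] by simp
qed simp

lemma sum_fun_apply: "(\<Sum>i\<in>I. F i) x = (\<Sum>i\<in>I. F i x)" for F :: "'i \<Rightarrow> 'a \<Rightarrow> 'b::comm_monoid_add"
  by (induction I rule: infinite_finite_induct) auto

text \<open>The form occurring in \<^const>\<open>id_tensor_id\<close> is multilinear: this is where linearity of \<open>f\<close> enters.\<close>

lemma multilinear_on_id_tensor_id: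
  fixes s :: "'k::field \<Rightarrow> 'a::ab_group_add \<Rightarrow> 'a"
  assumes s: "vector_space s" and V: "module.subspace s V"
    and f: "linear_on pw_scale pw_scale (tensor_power s V k) (tensor_power s V l) f"
    and \<phi>: "multilinear_on (p + l + q) s (*) V UNIV \<phi>"
  shows "multilinear_on (p + k + q) s (*) V UNIV
    (\<lambda>us. f (pure_tensor s V (take k (drop p us))) (\<lambda>ws. \<phi> (take p us @ ws @ drop (p + k) us)))"
    (is "multilinear_on _ _ _ _ _ ?G")
proof (rule multilinear_onI)
  fix p' q' xs zs assume n: "p' + 1 + q' = p + k + q" and xs: "xs \<in> vecs p' V" and zs: "zs \<in> vecs q' V"
  have lx: "length xs = p'" "set xs \<subseteq> V" and lz: "length zs = q'" "set zs \<subseteq> V"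
    using xs zs by (auto simp: vecs_def)
  have sub: "set (take m zs) \<subseteq> V" "set (drop m zs) \<subseteq> V" "set (take m xs) \<subseteq> V" "set (drop m xs) \<subseteq> V" for m
    using lx(2) lz(2) by (auto dest!: in_set_takeD in_set_dropD)
  interpret s: vector_space s by fact
  have add: "s c v \<in> V" "v + v' \<in> V" if "v \<in> V" "v' \<in> V" for c v v'
    by (fact s.subspace_scale[OF V that(1)], fact s.subspace_add[OF V that])
  consider "p' < p" | "p \<le> p'" "p' < p + k" | "p + k \<le> p'" by linarith
  then show "linear_on s (*) V UNIV (\<lambda>v. ?G (xs @ v # zs))"
  proof cases
    case 1
    define j where "j = p - Suc p'"
    have p: "p = Suc (p' + j)" using 1 by (simp add: j_def)
    let ?a = "take j zs" and ?b = "take k (drop j zs)" and ?c = "drop (j + k) zs"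
    have G: "?G (xs @ v # zs) = f (pure_tensor s V ?b) (\<lambda>ws. \<phi> (xs @ v # ?a @ ws @ ?c))" for v
      using lx lz p by (simp add: drop_Cons' take_Cons')
    have b: "?b \<in> vecs k V" using lz n p sub
      by (auto simp: vecs_def dest!: in_set_takeD in_set_dropD)
    have T: "f (pure_tensor s V ?b) \<in> tensor_power s V l"
      using linear_onD(1)[OF f] pure_in_tensor_power[OF b] by blast
    have "linear_on s (*) V UNIV (\<lambda>v. t (\<lambda>ws. \<phi> (xs @ v # ?a @ ws @ ?c)))" if "t \<in> tensor_power s V l" for t
    proof -
      have ml: "multilinear_on l s (*) V UNIV (\<lambda>ws. \<phi> (xs @ v # ?a @ ws @ ?c))" if "v \<in> V" for v
        using multilinear_on_sandwich[OF \<phi>, of "xs @ v # ?a" ?c] that lx lz n p sub by (simp add: vecs_def)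
      show ?thesis using that
      proof (induction rule: tensor_power_induct)
        case zero
        show ?case by (auto intro!: linear_onI)
      next
        case (step c vs t)
        have 1: "xs \<in> vecs p' V" "?a @ vs @ ?c \<in> vecs (j + l + q) V"
          using xs step.hyps lz n p sub by (auto simp: vecs_def)
        have "linear_on s (*) V UNIV (\<lambda>v. \<phi> (xs @ v # ?a @ vs @ ?c))"
          using multilinear_onD(2)[OF \<phi> _ 1] p by simp
        note L = linear_onD[OF this] linear_onD[OF step.IH]
        show ?case
          using L pure_tensor_apply[OF step.hyps(1) ml] add
          by (intro linear_onI) (simp_all add: pw_scale_def algebra_simps)
      qed
    qed
    from this[OF T] show ?thesis unfolding G .
  next
    case 2
    define j where "j = p' - p"
    define m where "m = k - Suc j"
    have p: "p' = p + j" "k = Suc (j + m)" using 2 by (auto simp: j_def m_def)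
    let ?a = "take p xs" and ?b = "drop p xs" and ?c = "take m zs" and ?d = "drop m zs"
    have G: "?G (xs @ v # zs) = f (pure_tensor s V (?b @ v # ?c)) (\<lambda>ws. \<phi> (?a @ ws @ ?d))" for v
      using lx lz p by (simp add: drop_Cons' take_Cons')
    have bc: "?b \<in> vecs j V" "?c \<in> vecs m V" using lx lz p n sub by (auto simp: vecs_def)
    have in1: "pure_tensor s V (?b @ v # ?c) \<in> tensor_power s V k" if "v \<in> V" for v
      using pure_in_tensor_power[OF vecs_insert[OF bc that]] p by simp
    have "linear_on s pw_scale V (tensor_power s V k) (\<lambda>v. pure_tensor s V (?b @ v # ?c))"
      using multilinear_onD(2)[OF multilinear_on_pure_tensor[OF V s] _ bc] p by simp
    note L = linear_onD[OF this]
    show ?thesis unfolding G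
      using L linear_onD[OF f] in1 by (intro linear_onI) (auto simp: pw_scale_def)
  next
    case 3
    define j where "j = p' - (p + k)"
    have p: "p' = p + k + j" using 3 by (simp add: j_def)
    let ?a = "take p xs" and ?b = "take k (drop p xs)" and ?c = "drop (p + k) xs"
    have G: "?G (xs @ v # zs) = f (pure_tensor s V ?b) (\<lambda>ws. \<phi> (?a @ ws @ ?c @ v # zs))" for v
      using lx lz p by simp
    have b: "?b \<in> vecs k V" using lx n p sub
      by (auto simp: vecs_def dest!: in_set_takeD in_set_dropD)
    have T: "f (pure_tensor s V ?b) \<in> tensor_power s V l"
      using linear_onD(1)[OF f] pure_in_tensor_power[OF b] by blast
    have "linear_on s (*) V UNIV (\<lambda>v. t (\<lambda>ws. \<phi> (?a @ ws @ ?c @ v # zs)))" if "t \<in> tensor_power s V l" for t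
    proof -
      have ml: "multilinear_on l s (*) V UNIV (\<lambda>ws. \<phi> (?a @ ws @ ?c @ v # zs))" if "v \<in> V" for v
        using multilinear_on_sandwich[OF \<phi>, of "?a" "?c @ v # zs"] that lx lz n p sub by (simp add: vecs_def)
      show ?thesis using that
      proof (induction rule: tensor_power_induct)
        case zero
        show ?case by (auto intro!: linear_onI)
      next
        case (step c vs t)
        have 1: "?a @ vs @ ?c \<in> vecs (p + l + j) V" "zs \<in> vecs q' V"
          using zs step.hyps lx n p sub by (auto simp: vecs_def)
        have "linear_on s (*) V UNIV (\<lambda>v. \<phi> (?a @ vs @ ?c @ v # zs))"
          using multilinear_onD(2)[OF \<phi> _ 1] p n by simp
        note L = linear_onD[OF this] linear_onD[OF step.IH]
        show ?case
          using L pure_tensor_apply[OF step.hyps(1) ml] add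
          by (intro linear_onI) (simp_all add: pw_scale_def algebra_simps)
      qed
    qed
    from this[OF T] show ?thesis unfolding G .
  qed
qed simp

lemma id_tensor_id_pure:
  fixes s :: "'k::field \<Rightarrow> 'a::ab_group_add \<Rightarrow> 'a"
  assumes s: "vector_space s" and V: "module.subspace s V"
    and f: "linear_on pw_scale pw_scale (tensor_power s V k) (tensor_power s V l) f"
    and xs: "xs \<in> vecs p V" and ys: "ys \<in> vecs k V" and zs: "zs \<in> vecs q V"
    and fys: "f (pure_tensor s V ys) = (\<Sum>i\<in>I. pw_scale (c i) (pure_tensor s V (ws i)))"
    and ws: "\<And>i. i \<in> I \<Longrightarrow> ws i \<in> vecs l V"
  shows "id_tensor_id s V p k f l q (pure_tensor s V (xs @ ys @ zs)) =
    (\<Sum>i\<in>I. pw_scale (c i) (pure_tensor s V (xs @ ws i @ zs)))"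
proof
  fix \<phi>
  have mem: "xs @ ys @ zs \<in> vecs (p + k + q) V" "\<And>i. i \<in> I \<Longrightarrow> xs @ ws i @ zs \<in> vecs (p + l + q) V"
    using xs ys zs ws by (auto simp: vecs_def)
  show "id_tensor_id s V p k f l q (pure_tensor s V (xs @ ys @ zs)) \<phi> =
    (\<Sum>i\<in>I. pw_scale (c i) (pure_tensor s V (xs @ ws i @ zs))) \<phi>"
  proof (cases "multilinear_on (p + l + q) s (*) V UNIV \<phi>")
    case True
    have "id_tensor_id s V p k f l q (pure_tensor s V (xs @ ys @ zs)) \<phi> =
      f (pure_tensor s V ys) (\<lambda>ws. \<phi> (xs @ ws @ zs))"
      using True xs ys zs
        pure_tensor_apply[OF mem(1) multilinear_on_id_tensor_id[OF s V f True]]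
      by (simp add: id_tensor_id_def vecs_def)
    also have "\<dots> = (\<Sum>i\<in>I. c i * \<phi> (xs @ ws i @ zs))"
      unfolding fys sum_fun_apply pw_scale_def
      by (intro sum.cong refl arg_cong2[of _ _ _ _ "(*)"]
        pure_tensor_apply[OF ws multilinear_on_sandwich[OF True xs zs]])
    also have "\<dots> = (\<Sum>i\<in>I. pw_scale (c i) (pure_tensor s V (xs @ ws i @ zs))) \<phi>"
      unfolding sum_fun_apply pw_scale_def
      by (intro sum.cong refl arg_cong2[of _ _ _ _ "(*)"] pure_tensor_apply[OF mem(2) True, symmetric])
    finally show ?thesis .
  next
    case False
    have "pure_tensor s V (xs @ ws i @ zs) \<phi> = 0" if "i \<in> I" for i
      using tensor_power_nonmultilinear[OF pure_in_tensor_power[OF mem(2)[OF that]] False] .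
    then show ?thesis using False by (simp add: id_tensor_id_def sum_fun_apply pw_scale_def)
  qed
qed

lemma tensor_power_explicit:
  assumes "t \<in> tensor_power s V n"
  shows "\<exists>(m::nat) c ws. (\<forall>i<m. ws i \<in> vecs n V) \<and> t = (\<Sum>i<m. pw_scale (c i) (pure_tensor s V (ws i)))"
  using assms
proof (induction rule: tensor_power_induct)
  case zero
  show ?case by (intro exI[of _ 0]) simp
next
  case (step c vs t)
  then obtain m :: nat and d ws where *: "\<forall>i<m. ws i \<in> vecs n V"
    "t = (\<Sum>i<m. pw_scale (d i) (pure_tensor s V (ws i)))" by blast
  then show ?case
    using step(1)
    by (intro exI[of _ "Suc m"] exI[of _ "d(m := c)"] exI[of _ "ws(m := vs)"])
      (auto simp: less_Suc_eq intro!: sum.cong)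
qed

lemma linear_on_id_tensor_id:
  fixes s :: "'k::field \<Rightarrow> 'a::ab_group_add \<Rightarrow> 'a"
  assumes s: "vector_space s" and V: "module.subspace s V"
    and f: "linear_on pw_scale pw_scale (tensor_power s V k) (tensor_power s V l) f"
  shows "linear_on pw_scale pw_scale (tensor_power s V (p + k + q)) (tensor_power s V (p + l + q))
    (id_tensor_id s V p k f l q)"
proof -
  let ?F = "id_tensor_id s V p k f l q"
  have add: "?F (t + t') = ?F t + ?F t'" for t t'
    by (auto simp: id_tensor_id_def fun_eq_iff)
  have scale: "?F (pw_scale c t) = pw_scale c (?F t)" for c t
    by (auto simp: id_tensor_id_def fun_eq_iff pw_scale_def)
  have "?F t \<in> tensor_power s V (p + l + q)" if "t \<in> tensor_power s V (p + k + q)" for t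
    using that
  proof (induction rule: tensor_power_induct)
    case zero
    have "?F 0 = 0" by (auto simp: id_tensor_id_def fun_eq_iff)
    then show ?case using pw.subspace_0[OF subspace_tensor_power] by (simp del: zero_fun_apply)
  next
    case (step c us t)
    define xs ys zs where "xs = take p us" and "ys = take k (drop p us)" and "zs = drop (p + k) us"
    have us: "us = xs @ ys @ zs"
      by (simp add: xs_def ys_def zs_def) (metis add.commute append_take_drop_id drop_drop)
    have m: "xs \<in> vecs p V" "ys \<in> vecs k V" "zs \<in> vecs q V"
      using step.hyps(1) by (auto simp: vecs_def xs_def ys_def zs_def dest!: in_set_takeD in_set_dropD)
    have "f (pure_tensor s V ys) \<in> tensor_power s V l"
      using linear_onD(1)[OF f pure_in_tensor_power[OF m(2)]] .
    then obtain r :: nat and d ws where w: "\<forall>i<r. ws i \<in> vecs l V"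
      "f (pure_tensor s V ys) = (\<Sum>i<r. pw_scale (d i) (pure_tensor s V (ws i)))"
      using tensor_power_explicit by blast
    have "?F (pure_tensor s V us) = (\<Sum>i<r. pw_scale (d i) (pure_tensor s V (xs @ ws i @ zs)))"
      unfolding us using w by (intro id_tensor_id_pure[OF s V f m]) auto
    moreover have "xs @ ws i @ zs \<in> vecs (p + l + q) V" if "i < r" for i
      using w that m by (auto simp: vecs_def)
    ultimately have "?F (pure_tensor s V us) \<in> tensor_power s V (p + l + q)"
      using subspace_tensor_power pw.subspace_sum pw.subspace_scale pure_in_tensor_power
      by (metis (no_types, lifting) lessThan_iff)
    then show ?case
      unfolding add scale using step.IH pw.subspace_add pw.subspace_scale subspace_tensor_power by blast
  qed
  then show ?thesis using add scale by (intro linear_onI) auto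
qed

lemma subspace_dual_space:
  assumes "vector_space s"
  shows "module.subspace pw_scale (dual_space s)"
  using assms unfolding pw.subspace_def
  by (auto simp: dual_space_def Vector_Spaces.linear_iff pw_scale_def vector_space_times algebra_simps)

lemma multilinear_on_prod_dual:
  fixes s :: "'k::field \<Rightarrow> 'a::ab_group_add \<Rightarrow> 'a"
  shows "multilinear_on n pw_scale (*) (dual_space s) UNIV (\<lambda>fs. \<Prod>i<n. (fs ! i) (as ! i))"
    and "vector_space s \<Longrightarrow> fs \<in> vecs n (dual_space s) \<Longrightarrow>
      multilinear_on n s (*) UNIV UNIV (\<lambda>as. \<Prod>i<n. (fs ! i) (as ! i))"
proof -
  have split: "(\<Prod>i<n. h i) = h p * (\<Prod>i\<in>{..<n} - {p}. h i)" if "p < n" for h :: "nat \<Rightarrow> 'k" and p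
    using that by (simp add: prod.remove)
  have nth: "(xs @ v # zs) ! length xs = v" "i \<noteq> length xs \<Longrightarrow> (xs @ v # zs) ! i = (xs @ 0 # zs) ! i"
    for xs zs :: "'c::zero list" and v i
    by (auto simp: nth_append nth_Cons split: nat.split)
  show "multilinear_on n pw_scale (*) (dual_space s) UNIV (\<lambda>fs. \<Prod>i<n. (fs ! i) (as ! i))"
  proof (rule multilinear_onI)
    fix p q and xs zs :: "('a \<Rightarrow> 'k) list" assume "p + 1 + q = n" "xs \<in> vecs p (dual_space s)"
    then have p: "p < n" "length xs = p" by (auto simp: vecs_def)
    have "(\<Prod>i<n. ((xs @ v # zs) ! i) (as ! i)) =
      v (as ! p) * (\<Prod>i\<in>{..<n} - {p}. ((xs @ 0 # zs) ! i) (as ! i))" for v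
    proof -
      have "(\<Prod>i\<in>{..<n} - {p}. ((xs @ v # zs) ! i) (as ! i)) =
        (\<Prod>i\<in>{..<n} - {p}. ((xs @ 0 # zs) ! i) (as ! i))"
        using p(2) by (intro prod.cong refl, subst nth(2)) auto
      then show ?thesis unfolding split[OF p(1)] using nth(1)[of xs v zs] p(2) by (simp del: zero_fun_apply)
    qed
    then show "linear_on pw_scale (*) (dual_space s) UNIV (\<lambda>v. \<Prod>i<n. ((xs @ v # zs) ! i) (as ! i))"
      by (intro linear_onI) (auto simp: pw_scale_def algebra_simps)
  qed simp
  show "multilinear_on n s (*) UNIV UNIV (\<lambda>as. \<Prod>i<n. (fs ! i) (as ! i))"
    if s: "vector_space s" and fs: "fs \<in> vecs n (dual_space s)"
  proof (rule multilinear_onI)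
    fix p q and xs zs :: "'a list" assume "p + 1 + q = n" "xs \<in> vecs p UNIV"
    then have p: "p < n" "length xs = p" by (auto simp: vecs_def)
    have "(\<Prod>i<n. (fs ! i) ((xs @ v # zs) ! i)) =
      (fs ! p) v * (\<Prod>i\<in>{..<n} - {p}. (fs ! i) ((xs @ 0 # zs) ! i))" for v
    proof -
      have "(\<Prod>i\<in>{..<n} - {p}. (fs ! i) ((xs @ v # zs) ! i)) =
        (\<Prod>i\<in>{..<n} - {p}. (fs ! i) ((xs @ 0 # zs) ! i))"
        using p(2) by (intro prod.cong refl, subst nth(2)) auto
      then show ?thesis unfolding split[OF p(1)] using nth(1)[of xs v zs] p(2) by simp
    qed
    moreover have "fs ! p \<in> dual_space s" using fs p by (auto simp: vecs_def)
    ultimately show "linear_on s (*) UNIV UNIV (\<lambda>v. \<Prod>i<n. (fs ! i) ((xs @ v # zs) ! i))"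
      by (intro linear_onI) (auto simp: dual_space_def Vector_Spaces.linear_iff algebra_simps)
  qed simp
qed

lemma dual_tensor_map_pure:
  assumes s: "vector_space s" and fs: "fs \<in> vecs n (dual_space s)" and as: "as \<in> vecs n UNIV"
  shows "dual_tensor_map n (pure_tensor pw_scale (dual_space s) fs) (pure_tensor s UNIV as) =
    (\<Prod>i<n. (fs ! i) (as ! i))"
  using pure_tensor_apply[OF fs multilinear_on_prod_dual(1)]
    pure_tensor_apply[OF as multilinear_on_prod_dual(2)[OF s fs]]
  by (simp add: dual_tensor_map_def)

lemma linear_on_dual_tensor_map_right:
  "linear_on pw_scale (*) (tensor_power s UNIV n) UNIV (dual_tensor_map n u)"
  by (intro linear_onI) (simp_all add: dual_tensor_map_def pw_scale_def)

lemma linear_on_dual_tensor_map_left: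
  assumes s: "vector_space s" and t: "t \<in> tensor_power s UNIV n"
  shows "linear_on pw_scale (*) (tensor_power pw_scale (dual_space s) n) UNIV (\<lambda>u. dual_tensor_map n u t)"
proof -
  let ?D = "tensor_power pw_scale (dual_space s) n"
  define G where "G u = (\<lambda>as. u (\<lambda>fs. \<Prod>i<n. (fs ! i) (as ! i)))" for u :: "('a, 'b \<Rightarrow> 'a) tensor"
  have ml: "multilinear_on n s (*) UNIV UNIV (G u)" if "u \<in> ?D" for u
    using that
  proof (induction rule: tensor_power_induct)
    case zero
    show ?case by (auto simp: G_def intro!: multilinear_onI linear_onI)
  next
    case (step c fs u)
    note M = multilinear_on_prod_dual(2)[OF s step(1)]
    have G: "G (pw_scale c (pure_tensor pw_scale (dual_space s) fs) + u) as =
      c * (\<Prod>i<n. (fs ! i) (as ! i)) + G u as" for as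
      using pure_tensor_apply[OF step(1) multilinear_on_prod_dual(1)] by (simp add: G_def pw_scale_def)
    show ?case
    proof (rule multilinear_onI)
      fix p q and xs zs :: "'b list" assume a: "p + 1 + q = n" "xs \<in> vecs p UNIV" "zs \<in> vecs q UNIV"
      show "linear_on s (*) UNIV UNIV
        (\<lambda>v. G (pw_scale c (pure_tensor pw_scale (dual_space s) fs) + u) (xs @ v # zs))"
        unfolding G
        using linear_onD[OF multilinear_onD(2)[OF M a]] linear_onD[OF multilinear_onD(2)[OF step(3) a]]
        by (intro linear_onI) (simp_all add: algebra_simps)
    qed simp
  qed
  have add: "t (\<lambda>as. \<phi> as + \<psi> as) = t \<phi> + t \<psi>" and scale: "t (\<lambda>as. c * \<phi> as) = c * t \<phi>"
    if "multilinear_on n s (*) UNIV UNIV \<phi>" "multilinear_on n s (*) UNIV UNIV \<psi>" for \<phi> \<psi> c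
  proof -
    have 1: "multilinear_on n s (*) UNIV UNIV (\<lambda>as. \<phi> as + \<psi> as)"
      and 2: "multilinear_on n s (*) UNIV UNIV (\<lambda>as. c * \<phi> as)"
      using that by (auto simp: multilinear_on_def linear_on_def algebra_simps)
    show "t (\<lambda>as. \<phi> as + \<psi> as) = t \<phi> + t \<psi>" using t
    proof (induction rule: tensor_power_induct)
      case (step d vs t)
      then show ?case
        by (simp add: pw_scale_def pure_tensor_apply[OF step(1)] that 1 algebra_simps)
    qed simp
    show "t (\<lambda>as. c * \<phi> as) = c * t \<phi>" using t
    proof (induction rule: tensor_power_induct)
      case (step d vs t)
      then show ?case
        by (simp add: pw_scale_def pure_tensor_apply[OF step(1)] that 2 algebra_simps)
    qed simp
  qed
  have "dual_tensor_map n u t = t (G u)" for u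
    by (simp add: dual_tensor_map_def G_def)
  moreover have "G (u + u') = (\<lambda>as. G u as + G u' as)" "G (pw_scale c u) = (\<lambda>as. c * G u as)" for u u' c
    by (simp_all add: G_def pw_scale_def)
  ultimately show ?thesis
    using add scale[OF ml ml] ml by (intro linear_onI) simp_all
qed

end

theory Submission
  imports Defs
begin

text \<open>Let \<open>b\<close> run over a finite basis of \<open>A\<close> and let \<open>b\<^sup>*\<close> be the dual basis. Expanding multilinear maps
  along these bases shows that a tensor over the dual is determined by its pairings with pure
  tensors over \<open>A\<close>, and that \<open>\<Delta> f = (\<Sum>b\<^sub>1,\<dots>,b\<^sub>n. f (\<mu> (b\<^sub>1 \<otimes> \<dots> \<otimes> b\<^sub>n)) b\<^sub>1\<^sup>* \<otimes> \<dots> \<otimes> b\<^sub>n\<^sup>*)\<close> pairs with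
  \<open>t\<close> to \<open>f (\<mu> t)\<close>. Hence \<open>Id\<^sub>p \<otimes> \<Delta> \<otimes> Id\<^sub>q\<close> is adjoint to \<open>Id\<^sub>p \<otimes> \<mu> \<otimes> Id\<^sub>q\<close> for this pairing, and
  the pairing of the coassociativity sum with a pure tensor is \<open>f\<close> applied to the
  associativity sum.\<close>

section \<open>Lists of vectors and the expansion of multilinear maps\<close>

lemma vecs_0 [simp]: "vecs 0 V = {[]}"
  by (auto simp: vecs_def)

lemma vecs_Suc: "vecs (Suc n) V = (\<lambda>(v, vs). v # vs) ` (V \<times> vecs n V)"
  by (force simp: vecs_def length_Suc_conv image_iff)

lemma finite_vecs: "finite V \<Longrightarrow> finite (vecs n V)"
  by (induction n) (simp_all add: vecs_Suc)

lemma sum_vecs_Suc: "(\<Sum>vs\<in>vecs (Suc n) V. F vs) = (\<Sum>v\<in>V. \<Sum>vs\<in>vecs n V. F (v # vs))"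
proof -
  have "inj_on (\<lambda>(v, vs). v # vs) (V \<times> vecs n V)" by (auto simp: inj_on_def)
  then show ?thesis
    by (simp add: vecs_Suc sum.reindex sum.cartesian_product case_prod_unfold)
qed

text \<open>Makes the pairing of pure tensors multiplicative under concatenation: prefixes of equal
  length keep the two suffixes aligned after the shift by \<open>p\<close>.\<close>

lemma prod_nth_append:
  fixes F :: "'a \<Rightarrow> 'b \<Rightarrow> 'c::comm_monoid_mult"
  assumes "length xs = length as" "p = length xs"
  shows "(\<Prod>i<p + q. F ((xs @ ys) ! i) ((as @ bs) ! i)) =
    (\<Prod>i<p. F (xs ! i) (as ! i)) * (\<Prod>i<q. F (ys ! i) (bs ! i))"
  using assms
proof (induction xs as arbitrary: p rule: list_induct2)
  case (Cons x xs a as)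
  then show ?case by (simp add: prod.lessThan_Suc_shift mult.assoc del: prod.lessThan_Suc)
qed simp

lemma linear_on_sum:
  assumes s: "vector_space s" and s': "vector_space s'" and V: "module.subspace s V"
    and f: "linear_on s s' V W f" and "finite I" and "\<And>i. i \<in> I \<Longrightarrow> v i \<in> V"
  shows "f (\<Sum>i\<in>I. s (c i) (v i)) = (\<Sum>i\<in>I. s' (c i) (f (v i)))"
proof -
  interpret s: vector_space s by fact
  interpret s': vector_space s' by fact
  show ?thesis using assms(5,6)
  proof (induction I rule: finite_induct)
    case empty
    \<comment> \<open>\<open>linear_on\<close> has no clause for zero, so \<open>f 0 = 0\<close> is
      obtained by scaling by 0.\<close>
    have "f (s 0 0) = s' 0 (f 0)" using linear_onD(3)[OF f s.subspace_0[OF V]] .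
    then show ?case by simp
  next
    case (insert i I)
    have "(\<Sum>i\<in>I. s (c i) (v i)) \<in> V" "s (c i) (v i) \<in> V"
      using insert.prems by (auto intro!: s.subspace_sum[OF V] s.subspace_scale[OF V])
    then show ?case
      using insert linear_onD(2,3)[OF f] by simp
  qed
qed

lemma multilinear_on_Cons:
  assumes "multilinear_on (Suc n) s s' V W g" "v \<in> V"
  shows "multilinear_on n s s' V W (\<lambda>vs. g (v # vs))"
proof (rule multilinear_onI)
  fix vs assume "vs \<in> vecs n V"
  then show "g (v # vs) \<in> W" using multilinear_onD(1)[OF assms(1)] assms(2) by (simp add: vecs_def)
next
  fix p q xs zs assume "p + 1 + q = n" "xs \<in> vecs p V" "zs \<in> vecs q V"
  then show "linear_on s s' V W (\<lambda>w. g (v # xs @ w # zs))"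
    using multilinear_onD(2)[OF assms(1), of "Suc p" q "v # xs" zs] assms(2) by (simp add: vecs_def)
qed

text \<open>Induction on the arity: expand the first argument by linearity, then apply the
  hypothesis to the form with that argument fixed. The family \<open>e\<close> and the coefficients
  \<open>c\<close> are kept abstract so that the lemma serves both a space with its basis
  (\<open>e\<close> the identity, \<open>c\<close> the dual vectors) and the dual with the dual
  basis (\<open>c\<close> evaluation at basis vectors).\<close>

lemma multilinear_on_expand:
  assumes s: "vector_space s" and s': "vector_space s'" and V: "module.subspace s V"
    and B: "finite B" and e: "\<And>b. b \<in> B \<Longrightarrow> e b \<in> V"
    and c: "\<And>v. v \<in> V \<Longrightarrow> v = (\<Sum>b\<in>B. s (c v b) (e b))"
    and "multilinear_on n s s' V W g" and "vs \<in> vecs n V"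
  shows "g vs = (\<Sum>bs\<in>vecs n B. s' (\<Prod>i<n. c (vs ! i) (bs ! i)) (g (map e bs)))"
  using assms(7,8)
proof (induction n arbitrary: g vs)
  case 0
  interpret s': vector_space s' by fact
  show ?case using 0 by simp
next
  case (Suc n)
  interpret s': vector_space s' by fact
  obtain v ws where vs: "vs = v # ws" "v \<in> V" "ws \<in> vecs n V"
    using Suc.prems by (auto simp: vecs_Suc)
  have lin: "linear_on s s' V W (\<lambda>v. g (v # ws))"
    using multilinear_onD(2)[OF Suc.prems(1), of 0 n "[]" ws] vs by simp
  have "g vs = g ((\<Sum>b\<in>B. s (c v b) (e b)) # ws)" using c[OF vs(2)] vs by simp
  also have "\<dots> = (\<Sum>b\<in>B. s' (c v b) (g (e b # ws)))"
    using linear_on_sum[OF s s' V lin B e] .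
  also have "\<dots> = (\<Sum>b\<in>B. s' (c v b) (\<Sum>bs\<in>vecs n B.
      s' (\<Prod>i<n. c (ws ! i) (bs ! i)) (g (e b # map e bs))))"
    using Suc.IH[OF multilinear_on_Cons[OF Suc.prems(1) e] vs(3)] by simp
  also have "\<dots> = (\<Sum>bs\<in>vecs (Suc n) B. s' (\<Prod>i<Suc n. c (vs ! i) (bs ! i)) (g (map e bs)))"
    by (simp add: sum_vecs_Suc s'.scale_sum_right vs prod.lessThan_Suc_shift del: prod.lessThan_Suc)
  finally show ?case .
qed

lemma multilinear_on_compose:
  assumes "multilinear_on n s s' V W g" "linear_on s' s'' W X h"
  shows "multilinear_on n s s'' V X (\<lambda>vs. h (g vs))"
proof (rule multilinear_onI)
  fix vs assume "vs \<in> vecs n V"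
  then show "h (g vs) \<in> X" using multilinear_onD(1)[OF assms(1)] linear_onD(1)[OF assms(2)] by blast
next
  fix p q xs zs assume "p + 1 + q = n" "xs \<in> vecs p V" "zs \<in> vecs q V"
  then have "linear_on s s' V W (\<lambda>v. g (xs @ v # zs))" by (rule multilinear_onD(2)[OF assms(1)])
  then show "linear_on s s'' V X (\<lambda>v. h (g (xs @ v # zs)))"
    using assms(2) by (simp add: linear_on_def)
qed

lemma linear_on_compose:
  assumes "linear_on s s' V W g" "linear_on s' s'' W X h"
  shows "linear_on s s'' V X (\<lambda>v. h (g v))"
  using assms by (simp add: linear_on_def)

lemma linear_on_dual_space: "f \<in> dual_space s \<Longrightarrow> linear_on s (*) UNIV UNIV f"
  by (simp add: dual_space_def Vector_Spaces.linear_iff linear_on_def)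

text \<open>Needed because the coassociativity sum hands \<open>id_tensor_id\<close> the
  comultiplication precomposed with this inverse, and \<open>id_tensor_id\<close> behaves as
  intended for linear maps.\<close>

lemma linear_on_the_inv_tensor1:
  assumes s: "vector_space s" and V: "module.subspace s V"
  shows "linear_on pw_scale s (tensor_power s V 1) V (the_inv_into V (tensor1 s V))"
proof -
  interpret s: vector_space s by fact
  note bij = bij_betw_tensor1[OF s V] and lin = linear_onD[OF linear_on_tensor1[OF s V]]
  have inj: "inj_on (tensor1 s V) V" and im: "tensor_power s V 1 = tensor1 s V ` V"
    using bij by (auto simp: bij_betw_def)
  have inv: "the_inv_into V (tensor1 s V) (tensor1 s V x) = x" if "x \<in> V" for x
    using the_inv_into_f_f[OF inj that] .
  show ?thesis unfolding im
  proof (rule linear_onI)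
    fix t u assume "t \<in> tensor1 s V ` V" "u \<in> tensor1 s V ` V"
    then obtain x y where "x \<in> V" "y \<in> V" "t = tensor1 s V x" "u = tensor1 s V y" by blast
    then show "the_inv_into V (tensor1 s V) (t + u) = the_inv_into V (tensor1 s V) t + the_inv_into V (tensor1 s V) u"
      using lin(2)[of x y] inv s.subspace_add[OF V] by metis
  next
    fix c t assume "t \<in> tensor1 s V ` V"
    then obtain x where "x \<in> V" "t = tensor1 s V x" by blast
    then show "the_inv_into V (tensor1 s V) (pw_scale c t) = s c (the_inv_into V (tensor1 s V) t)"
      using lin(3)[of x c] inv s.subspace_scale[OF V] by metis
  qed (auto simp: inv)
qed

section \<open>The dual basis and tensors over the dual\<close>

context finite_dimensional_vector_space
begin

text \<open>For \<open>b\<close> in \<open>Basis\<close> this is the coordinate functional of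
  \<open>b\<close>; for any other \<open>b\<close> it is the zero functional, hence still an element
  of the dual.\<close>

definition dual_vector :: "'b \<Rightarrow> 'b \<Rightarrow> 'a"
  where "dual_vector b = (\<lambda>v. representation Basis v b)"

lemma dual_vector_in_dual_space: "dual_vector b \<in> dual_space scale"
  unfolding dual_space_def dual_vector_def Vector_Spaces.linear_iff
  by (simp add: vector_space_axioms vector_space_times independent_Basis span_Basis
      representation_add representation_scale)

lemma vector_expand: "v = (\<Sum>b\<in>Basis. scale (dual_vector b v) b)"
  unfolding dual_vector_def
  by (rule sum_representation_eq[symmetric])
    (simp_all add: independent_Basis span_Basis finite_Basis)

lemma dual_space_expand:
  assumes "f \<in> dual_space scale"
  shows "f = (\<Sum>b\<in>Basis. pw_scale (f b) (dual_vector b))"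
proof
  fix v
  have "f v = f (\<Sum>b\<in>Basis. scale (dual_vector b v) b)" using vector_expand[of v] by simp
  also have "\<dots> = (\<Sum>b\<in>Basis. dual_vector b v * f b)"
    by (rule linear_on_sum[OF vector_space_axioms vector_space_times subspace_UNIV
          linear_on_dual_space[OF assms] finite_Basis]) simp
  finally show "f v = (\<Sum>b\<in>Basis. pw_scale (f b) (dual_vector b)) v"
    by (simp add: sum_fun_apply pw_scale_def mult.commute)
qed

text \<open>Both sides are linear in \<open>u\<close>, so pure tensors suffice. There the claim is
  the multilinear expansion along the dual basis: the coefficient of \<open>f\<close> at
  \<open>dual_vector b\<close> is \<open>f b\<close>, and the product of these coefficients is the
  pairing with the basis tensor \<open>bs\<close>.\<close>

lemma dual_tensor_expand:
  assumes "u \<in> tensor_power pw_scale (dual_space scale) m"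
  shows "u = (\<Sum>bs\<in>vecs m Basis. pw_scale (dual_tensor_map m u (pure_tensor scale UNIV bs))
    (pure_tensor pw_scale (dual_space scale) (map dual_vector bs)))"
    (is "u = ?E u")
proof -
  let ?D = "dual_space scale" and ?T = "tensor_power pw_scale (dual_space scale) m"
  have D: "module.subspace pw_scale ?D" by (rule subspace_dual_space[OF vector_space_axioms])
  have bs: "bs \<in> vecs m UNIV" if "bs \<in> vecs m Basis" for bs using that by (auto simp: vecs_def)
  \<comment> \<open>With \<open>UNIV\<close> as target no membership of \<open>?E\<close> has to be
    shown; additivity and homogeneity are what the comparison on pure tensors uses.\<close>
  have lin: "linear_on pw_scale pw_scale ?T UNIV ?E"
  proof (rule linear_onI)
    fix t u assume tu: "t \<in> ?T" "u \<in> ?T"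
    show "?E (t + u) = ?E t + ?E u"
      unfolding sum.distrib[symmetric]
      by (rule sum.cong[OF refl], subst linear_onD(2)[OF linear_on_dual_tensor_map_left[OF
            vector_space_axioms pure_in_tensor_power[OF bs]]]) (auto simp only: tu pw.scale_left_distrib)
  next
    fix c t assume t: "t \<in> ?T"
    show "?E (pw_scale c t) = pw_scale c (?E t)"
      unfolding pw.scale_sum_right
      by (rule sum.cong[OF refl], subst linear_onD(3)[OF linear_on_dual_tensor_map_left[OF
            vector_space_axioms pure_in_tensor_power[OF bs]]]) (auto simp only: t pw.scale_scale)
  qed simp
  have "linear_on pw_scale pw_scale ?T UNIV (\<lambda>u. u)" by (simp add: linear_on_def)
  then show ?thesis
  proof (rule linear_on_eq_tensor_power[OF vector_space_pw_scale _ lin _ assms])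
    fix fs assume fs: "fs \<in> vecs m ?D"
    have "pure_tensor pw_scale ?D fs = (\<Sum>bs\<in>vecs m Basis. pw_scale (\<Prod>i<m. (fs ! i) (bs ! i))
        (pure_tensor pw_scale ?D (map dual_vector bs)))"
      by (rule multilinear_on_expand[OF vector_space_pw_scale vector_space_pw_scale D finite_Basis
          dual_vector_in_dual_space dual_space_expand
          multilinear_on_pure_tensor[OF D vector_space_pw_scale] fs])
    also have "\<dots> = ?E (pure_tensor pw_scale ?D fs)"
      by (rule sum.cong[OF refl]) (simp only: dual_tensor_map_pure[OF vector_space_axioms fs bs])
    finally show "pure_tensor pw_scale ?D fs = ?E (pure_tensor pw_scale ?D fs)" .
  qed
qed

text \<open>Injectivity of the canonical map into the dual of the tensor power: all coefficients in
  \<open>dual_tensor_expand\<close> vanish. It reduces identities between tensors over the dual to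
  identities between scalars.\<close>

lemma dual_tensor_eq_0:
  assumes "u \<in> tensor_power pw_scale (dual_space scale) m"
    and "\<And>as. as \<in> vecs m UNIV \<Longrightarrow> dual_tensor_map m u (pure_tensor scale UNIV as) = 0"
  shows "u = 0"
proof -
  have "dual_tensor_map m u (pure_tensor scale UNIV bs) = 0" if "bs \<in> vecs m Basis" for bs
    using that by (intro assms(2)) (auto simp: vecs_def)
  then show ?thesis using dual_tensor_expand[OF assms(1)] by simp
qed

section \<open>The comultiplication as transpose of the multiplication\<close>

definition dual_comult :: "nat \<Rightarrow> (('a, 'b) tensor \<Rightarrow> 'b) \<Rightarrow> ('b \<Rightarrow> 'a) \<Rightarrow> ('a, 'b \<Rightarrow> 'a) tensor"
  where "dual_comult n \<mu> f = (\<Sum>bs\<in>vecs n Basis. pw_scale (f (\<mu> (pure_tensor scale UNIV bs)))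
    (pure_tensor pw_scale (dual_space scale) (map dual_vector bs)))"

lemma linear_on_dual_comult:
  "linear_on pw_scale pw_scale (dual_space scale) (tensor_power pw_scale (dual_space scale) n)
    (dual_comult n \<mu>)"
proof (rule linear_onI)
  fix f
  have "map dual_vector bs \<in> vecs n (dual_space scale)" if "bs \<in> vecs n Basis" for bs
    using that dual_vector_in_dual_space by (auto simp: vecs_def)
  then show "dual_comult n \<mu> f \<in> tensor_power pw_scale (dual_space scale) n"
    unfolding dual_comult_def
    by (intro pw.subspace_sum[OF subspace_tensor_power] pw.subspace_scale[OF subspace_tensor_power]
        pure_in_tensor_power)
next
  fix f g
  show "dual_comult n \<mu> (f + g) = dual_comult n \<mu> f + dual_comult n \<mu> g"
    unfolding dual_comult_def sum.distrib[symmetric]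
    by (simp only: plus_fun_apply pw.scale_left_distrib)
next
  fix c f
  show "dual_comult n \<mu> (pw_scale c f) = pw_scale c (dual_comult n \<mu> f)"
    unfolding dual_comult_def pw.scale_sum_right pw.scale_scale by (simp add: pw_scale_def)
qed

text \<open>By linearity in \<open>t\<close> pure tensors suffice. A product of dual vectors
  evaluated at \<open>as\<close> is a product of coordinates, so the sum is the expansion of the
  multilinear form \<open>f (\<mu> (?P as))\<close> along the basis.\<close>

lemma dual_tensor_map_dual_comult:
  assumes \<mu>: "linear_on pw_scale scale (tensor_power scale UNIV n) UNIV \<mu>"
    and f: "f \<in> dual_space scale" and t: "t \<in> tensor_power scale UNIV n"
  shows "dual_tensor_map n (dual_comult n \<mu> f) t = f (\<mu> t)"
proof (rule linear_on_eq_tensor_power[OF vector_space_times linear_on_dual_tensor_map_right _ _ t])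
  let ?D = "dual_space scale" and ?P = "pure_tensor scale UNIV"
  show lin: "linear_on pw_scale (*) (tensor_power scale UNIV n) UNIV (\<lambda>t. f (\<mu> t))"
    by (rule linear_on_compose[OF \<mu> linear_on_dual_space[OF f]])
  fix as :: "'b list" assume as: "as \<in> vecs n UNIV"
  have dual: "map dual_vector bs \<in> vecs n ?D" if "bs \<in> vecs n Basis" for bs
    using that dual_vector_in_dual_space by (auto simp: vecs_def)
  have "dual_tensor_map n (dual_comult n \<mu> f) (?P as) = (\<Sum>bs\<in>vecs n Basis. f (\<mu> (?P bs)) *
      dual_tensor_map n (pure_tensor pw_scale ?D (map dual_vector bs)) (?P as))"
    unfolding dual_comult_def
    by (rule linear_on_sum[OF vector_space_pw_scale vector_space_times subspace_tensor_power
          linear_on_dual_tensor_map_left[OF vector_space_axioms pure_in_tensor_power[OF as]]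
          finite_vecs[OF finite_Basis] pure_in_tensor_power[OF dual]])
  \<comment> \<open>The identity \<open>map\<close> gives the term the shape of
    \<open>multilinear_on_expand\<close> with \<open>e\<close> the identity.\<close>
  also have "\<dots> = (\<Sum>bs\<in>vecs n Basis. (\<Prod>i<n. dual_vector (bs ! i) (as ! i)) * f (\<mu> (?P (map (\<lambda>b. b) bs))))"
  proof (rule sum.cong[OF refl])
    fix bs assume bs: "bs \<in> vecs n Basis"
    then have "length bs = n" by (simp add: vecs_def)
    then show "f (\<mu> (?P bs)) * dual_tensor_map n (pure_tensor pw_scale ?D (map dual_vector bs)) (?P as) =
      (\<Prod>i<n. dual_vector (bs ! i) (as ! i)) * f (\<mu> (?P (map (\<lambda>b. b) bs)))"
      by (simp add: dual_tensor_map_pure[OF vector_space_axioms dual[OF bs] as])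
  qed
  also have "\<dots> = f (\<mu> (?P as))"
    by (rule multilinear_on_expand[OF vector_space_axioms vector_space_times subspace_UNIV finite_Basis
          UNIV_I vector_expand multilinear_on_compose[OF
            multilinear_on_pure_tensor[OF subspace_UNIV vector_space_axioms] lin] as, symmetric])
  finally show "dual_tensor_map n (dual_comult n \<mu> f) (?P as) = f (\<mu> (?P as))" .
qed

lemma linear_on_dual_comult_tensor1:
  "linear_on pw_scale pw_scale (tensor_power pw_scale (dual_space scale) 1)
    (tensor_power pw_scale (dual_space scale) n)
    (\<lambda>u. dual_comult n \<mu> (the_inv_into (dual_space scale) (tensor1 pw_scale (dual_space scale)) u))"
  by (rule linear_on_compose[OF linear_on_the_inv_tensor1[OF vector_space_pw_scale
        subspace_dual_space[OF vector_space_axioms]] linear_on_dual_comult])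

text \<open>By linearity in \<open>u\<close> pure tensors suffice. The outer factors pair with
  \<open>xs\<close> and \<open>zs\<close> unchanged, while the middle functional \<open>f\<close>
  contributes the pairing of its comultiplication with \<open>ys\<close>, which is
  \<open>f (\<mu> (?P ys))\<close>.\<close>

lemma dual_tensor_map_id_tensor_dual_comult:
  assumes \<mu>: "linear_on pw_scale scale (tensor_power scale UNIV n) UNIV \<mu>"
    and u: "u \<in> tensor_power pw_scale (dual_space scale) (p + 1 + q)"
    and xs: "xs \<in> vecs p UNIV" and ys: "ys \<in> vecs n UNIV" and zs: "zs \<in> vecs q UNIV"
  shows "dual_tensor_map (p + n + q)
      (id_tensor_id pw_scale (dual_space scale) p 1
        (\<lambda>u. dual_comult n \<mu> (the_inv_into (dual_space scale) (tensor1 pw_scale (dual_space scale)) u)) n q u)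
      (pure_tensor scale UNIV (xs @ ys @ zs)) =
    dual_tensor_map (p + 1 + q) u
      (pure_tensor scale UNIV (xs @ [\<mu> (pure_tensor scale UNIV ys)] @ zs))"
    (is "dual_tensor_map _ (?I u) (?P _) = _")
proof -
  let ?D = "dual_space scale"
  let ?Q = "pure_tensor pw_scale ?D"
  let ?f = "\<lambda>u. dual_comult n \<mu> (the_inv_into ?D (tensor1 pw_scale ?D) u)"
  have D: "module.subspace pw_scale ?D" by (rule subspace_dual_space[OF vector_space_axioms])
  have as: "xs @ ys @ zs \<in> vecs (p + n + q) UNIV" "xs @ [\<mu> (?P ys)] @ zs \<in> vecs (p + 1 + q) UNIV"
    using xs ys zs by (auto simp: vecs_def)
  note left = linear_on_dual_tensor_map_left[OF vector_space_axioms pure_in_tensor_power]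
  note lin = linear_on_id_tensor_id[OF vector_space_pw_scale D linear_on_dual_comult_tensor1]
  show ?thesis
  proof (rule linear_on_eq_tensor_power[OF vector_space_times
        linear_on_compose[OF lin left[OF as(1)]] left[OF as(2)] _ u])
    fix us assume us: "us \<in> vecs (p + 1 + q) ?D"
    define fs f gs where "fs = take p us" "f = us ! p" "gs = drop (Suc p) us"
    have eq: "us = fs @ [f] @ gs"
      using us by (simp add: fs_f_gs_def vecs_def id_take_nth_drop)
    have mem: "fs \<in> vecs p ?D" "f \<in> ?D" "[f] \<in> vecs 1 ?D" "gs \<in> vecs q ?D"
      using us by (auto simp: fs_f_gs_def vecs_def dest!: in_set_takeD in_set_dropD)
    have f_pure: "?f (?Q [f]) = dual_comult n \<mu> f"
      using the_inv_into_f_f[OF bij_betw_imp_inj_on[OF bij_betw_tensor1[OF vector_space_pw_scale D]] mem(2)]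
      by (simp add: tensor1_def)
    \<comment> \<open>Any decomposition into pure tensors will do, since it is reassembled into
      \<open>dual_comult n \<mu> f\<close> before being evaluated.\<close>
    obtain r :: nat and c ws where ws: "\<And>i. i < r \<Longrightarrow> ws i \<in> vecs n ?D"
      and comult: "dual_comult n \<mu> f = (\<Sum>i<r. pw_scale (c i) (?Q (ws i)))"
      using tensor_power_explicit[OF linear_onD(1)[OF linear_on_dual_comult mem(2)]] by blast
    have I: "?I (?Q us) = (\<Sum>i<r. pw_scale (c i) (?Q (fs @ ws i @ gs)))"
      unfolding eq using ws
      by (intro id_tensor_id_pure[OF vector_space_pw_scale D linear_on_dual_comult_tensor1 mem(1,3,4)])
        (simp_all only: f_pure comult lessThan_iff)
    \<comment> \<open>The middle length \<open>k\<close> is left open: it is \<open>n\<close> for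
      the tensors \<open>ws i\<close> against \<open>ys\<close>, and 1 for \<open>[f]\<close>
      against \<open>[\<mu> (?P ys)]\<close>.\<close>
    have split: "(\<Prod>i<p + k + q. ((fs @ hs @ gs) ! i) ((xs @ bs @ zs) ! i)) =
        (\<Prod>i<p. (fs ! i) (xs ! i)) * (\<Prod>i<k. (hs ! i) (bs ! i)) * (\<Prod>i<q. (gs ! i) (zs ! i))"
      if "length hs = k" "length bs = k" for hs bs k
    proof -
      have l: "length fs = length xs" "p = length fs" using mem xs by (auto simp: vecs_def)
      have l': "length hs = length bs" "k = length hs" using that by auto
      show ?thesis
        unfolding add.assoc mult.assoc
          prod_nth_append[where F = "\<lambda>f a. f a", OF l] prod_nth_append[where F = "\<lambda>f a. f a", OF l'] ..
    qed
    have wsl: "fs @ ws i @ gs \<in> vecs (p + n + q) ?D" if "i < r" for i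
      using ws[OF that] mem by (auto simp: vecs_def)
    let ?F = "\<Prod>i<p. (fs ! i) (xs ! i)" and ?G = "\<Prod>i<q. (gs ! i) (zs ! i)"
    have "dual_tensor_map (p + n + q) (?I (?Q us)) (?P (xs @ ys @ zs)) =
        (\<Sum>i<r. c i * dual_tensor_map (p + n + q) (?Q (fs @ ws i @ gs)) (?P (xs @ ys @ zs)))"
      unfolding I
      by (rule linear_on_sum[OF vector_space_pw_scale vector_space_times subspace_tensor_power
            left[OF as(1)] finite_lessThan pure_in_tensor_power]) (use wsl in auto)
    also have "\<dots> = (\<Sum>i<r. c i * (?F * dual_tensor_map n (?Q (ws i)) (?P ys) * ?G))"
    proof (rule sum.cong[OF refl])
      fix i assume "i \<in> {..<r}"
      then have i: "i < r" by simp
      have "length (ws i) = n" "length ys = n" using ws[OF i] ys by (auto simp: vecs_def)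
      then show "c i * dual_tensor_map (p + n + q) (?Q (fs @ ws i @ gs)) (?P (xs @ ys @ zs)) =
          c i * (?F * dual_tensor_map n (?Q (ws i)) (?P ys) * ?G)"
        unfolding dual_tensor_map_pure[OF vector_space_axioms wsl[OF i] as(1)]
          dual_tensor_map_pure[OF vector_space_axioms ws[OF i] ys] by (simp only: split)
    qed
    also have "\<dots> = ?F * (\<Sum>i<r. c i * dual_tensor_map n (?Q (ws i)) (?P ys)) * ?G"
      by (simp add: sum_distrib_left sum_distrib_right algebra_simps)
    also have "(\<Sum>i<r. c i * dual_tensor_map n (?Q (ws i)) (?P ys)) =
        dual_tensor_map n (dual_comult n \<mu> f) (?P ys)"
      unfolding comult
      by (rule linear_on_sum[OF vector_space_pw_scale vector_space_times subspace_tensor_power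
            left[OF ys] finite_lessThan pure_in_tensor_power, symmetric]) (use ws in auto)
    also have "\<dots> = f (\<mu> (?P ys))"
      by (rule dual_tensor_map_dual_comult[OF \<mu> mem(2) pure_in_tensor_power[OF ys]])
    also have "?F * f (\<mu> (?P ys)) * ?G =
        (\<Prod>i<p + 1 + q. (us ! i) ((xs @ [\<mu> (?P ys)] @ zs) ! i))"
      unfolding eq by (subst split) simp_all
    also have "\<dots> = dual_tensor_map (p + 1 + q) (?Q us) (?P (xs @ [\<mu> (?P ys)] @ zs))"
      by (rule dual_tensor_map_pure[OF vector_space_axioms us as(2), symmetric])
    finally show "dual_tensor_map (p + n + q) (?I (?Q us)) (?P (xs @ ys @ zs)) =
        dual_tensor_map (p + 1 + q) (?Q us) (?P (xs @ [\<mu> (?P ys)] @ zs))" .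
  qed
qed

end

section \<open>The associativity terms on pure tensors, and coassociativity of the dual\<close>

lemma id_tensor_mult_pure:
  assumes s: "vector_space s" and V: "module.subspace s V"
    and \<mu>: "linear_on pw_scale s (tensor_power s V n) V \<mu>"
    and xs: "xs \<in> vecs p V" and ys: "ys \<in> vecs n V" and zs: "zs \<in> vecs q V"
  shows "id_tensor_id s V p n (\<lambda>u. tensor1 s V (\<mu> u)) 1 q (pure_tensor s V (xs @ ys @ zs)) =
    pure_tensor s V (xs @ [\<mu> (pure_tensor s V ys)] @ zs)"
  \<comment> \<open>Through \<open>tensor1\<close> the value of \<mu> is itself a pure tensor, so
    the sum has a single term with coefficient 1.\<close>
  using id_tensor_id_pure[OF s V linear_on_compose[OF \<mu> linear_on_tensor1[OF s V]] xs ys zs,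
      where I = "{()}" and c = "\<lambda>_. 1" and ws = "\<lambda>_. [\<mu> (pure_tensor s V ys)]"]
    linear_onD(1)[OF \<mu> pure_in_tensor_power[OF ys]]
  by (simp add: tensor1_def vecs_def)

text \<open>The zero map alone would witness bare existence of a coalgebra structure. The pairing
  clause excludes this choice whenever \<mu> is nonzero: it makes \<Delta> the transpose of \<mu>,
  which by \<open>dual_tensor_eq_0\<close> determines \<Delta> on the dual.\<close>

theorem proposition6:
  fixes n :: nat
    and scale :: "'k::field_char_0 \<Rightarrow> 'a::ab_group_add \<Rightarrow> 'a"
    and Basis :: "'a set"
    and \<mu> :: "('k, 'a) tensor \<Rightarrow> 'a"
  assumes "finite_dimensional_vector_space scale Basis"
    and "partially_associative_algebra n scale UNIV \<mu>"
  shows "\<exists>\<Delta>. partially_coassociative_coalgebra n pw_scale (dual_space scale) \<Delta> \<and>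
    (\<forall>f \<in> dual_space scale. \<forall>t \<in> tensor_power scale UNIV n.
      dual_tensor_map n (\<Delta> f) t = f (\<mu> t))"
proof -
  interpret finite_dimensional_vector_space scale Basis by fact
  let ?D = "dual_space scale" and ?P = "pure_tensor scale UNIV" and ?\<Delta> = "dual_comult n \<mu>"
  let ?I = "\<lambda>p. id_tensor_id pw_scale ?D p 1
    (\<lambda>u. ?\<Delta> (the_inv_into ?D (tensor1 pw_scale ?D) u)) n (n - 1 - p)"
  let ?J = "\<lambda>p. id_tensor_id scale UNIV p n (\<lambda>u. tensor1 scale UNIV (\<mu> u)) 1 (n - 1 - p)"
  have D: "module.subspace pw_scale ?D" by (rule subspace_dual_space[OF vector_space_axioms])
  have \<mu>: "linear_on pw_scale scale (tensor_power scale UNIV n) UNIV \<mu>"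
    and assoc: "\<And>t. t \<in> tensor_power scale UNIV (n + (n - 1)) \<Longrightarrow>
      (\<Sum>p<n. scale ((-1) ^ (p * (n - 1))) (\<mu> (?J p t))) = 0"
    using assms(2) by (auto simp: partially_associative_algebra_def)
  have "(\<Sum>p<n. pw_scale ((-1) ^ (p * (n - 1))) (?I p (?\<Delta> f))) = 0" (is "?S = 0") if f: "f \<in> ?D" for f
  proof (rule dual_tensor_eq_0[where m = "n + (n - 1)"])
    have \<Delta>f: "?\<Delta> f \<in> tensor_power pw_scale ?D n" by (rule linear_onD(1)[OF linear_on_dual_comult f])
    have I: "?I p (?\<Delta> f) \<in> tensor_power pw_scale ?D (n + (n - 1))" if "p < n" for p
    proof -
      \<comment> \<open>Subtraction on \<open>nat\<close> is truncated; \<open>p < n\<close> makes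
        both degree equations true.\<close>
      have "p + 1 + (n - 1 - p) = n" "p + n + (n - 1 - p) = n + (n - 1)" using that by auto
      then show ?thesis
        using linear_onD(1)[OF linear_on_id_tensor_id[OF vector_space_pw_scale D
              linear_on_dual_comult_tensor1, where p = p and q = "n - 1 - p"], of "?\<Delta> f"] \<Delta>f by metis
    qed
    then show "?S \<in> tensor_power pw_scale ?D (n + (n - 1))"
      by (intro pw.subspace_sum[OF subspace_tensor_power] pw.subspace_scale[OF subspace_tensor_power]) auto
    fix as :: "'a list" assume as: "as \<in> vecs (n + (n - 1)) UNIV"
    have adjoint: "dual_tensor_map (n + (n - 1)) (?I p (?\<Delta> f)) (?P as) = f (\<mu> (?J p (?P as)))"
      if "p < n" for p
    proof -
      define xs ys zs where "xs = take p as" "ys = take n (drop p as)" "zs = drop (n + p) as"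
      have eq: "as = xs @ ys @ zs"
        unfolding xs_ys_zs_def by (metis append_take_drop_id drop_drop)
      have m: "xs \<in> vecs p UNIV" "ys \<in> vecs n UNIV" "zs \<in> vecs (n - 1 - p) UNIV"
        using as that by (auto simp: vecs_def xs_ys_zs_def)
      have n: "p + 1 + (n - 1 - p) = n" "p + n + (n - 1 - p) = n + (n - 1)" using that by auto
      \<comment> \<open>Moving the inner \<Delta> across the pairing contracts \<open>as\<close> to
        this list of length \<open>n\<close>, so the outer \<open>?\<Delta> f\<close> can be
        transposed as well.\<close>
      have "xs @ [\<mu> (?P ys)] @ zs \<in> vecs n UNIV" using m that by (auto simp: vecs_def)
      then have "dual_tensor_map n (?\<Delta> f) (?P (xs @ [\<mu> (?P ys)] @ zs)) = f (\<mu> (?P (xs @ [\<mu> (?P ys)] @ zs)))"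
        by (intro dual_tensor_map_dual_comult[OF \<mu> f] pure_in_tensor_power)
      then show ?thesis
        using dual_tensor_map_id_tensor_dual_comult[OF \<mu> _ m, of "?\<Delta> f"] \<Delta>f
        unfolding n eq id_tensor_mult_pure[OF vector_space_axioms subspace_UNIV \<mu> m] by simp
    qed
    \<comment> \<open>Linearity in the first argument is available on the tensor power, hence the
      appeal to \<open>I\<close> for each summand.\<close>
    have "dual_tensor_map (n + (n - 1)) ?S (?P as) =
        (\<Sum>p<n. (-1) ^ (p * (n - 1)) * dual_tensor_map (n + (n - 1)) (?I p (?\<Delta> f)) (?P as))"
      by (rule linear_on_sum[OF vector_space_pw_scale vector_space_times subspace_tensor_power
            linear_on_dual_tensor_map_left[OF vector_space_axioms pure_in_tensor_power[OF as]]
            finite_lessThan]) (use I in auto)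
    also have "\<dots> = (\<Sum>p<n. (-1) ^ (p * (n - 1)) * f (\<mu> (?J p (?P as))))"
      using adjoint by (intro sum.cong refl) simp
    also have "\<dots> = f (\<Sum>p<n. scale ((-1) ^ (p * (n - 1))) (\<mu> (?J p (?P as))))"
      by (rule linear_on_sum[OF vector_space_axioms vector_space_times subspace_UNIV
            linear_on_dual_space[OF f] finite_lessThan, symmetric]) simp
    also have "\<dots> = f 0" using assoc[OF pure_in_tensor_power[OF as]] by simp
    also have "\<dots> = 0"
      using linear_onD(3)[OF linear_on_dual_space[OF f] UNIV_I, of 0 0] by simp
    finally show "dual_tensor_map (n + (n - 1)) ?S (?P as) = 0" .
  qed
  then have "partially_coassociative_coalgebra n pw_scale ?D ?\<Delta>"
    using vector_space_pw_scale D linear_on_dual_comult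
    by (simp add: partially_coassociative_coalgebra_def del: zero_fun_apply)
  then show ?thesis using dual_tensor_map_dual_comult[OF \<mu>] by blast
qed

end
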